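(* Let $X$ be a Tychonoff space which is a countable union of closed subspaces $X_n$, $n\in\omega$, where each $X_n$ is a $\Delta$-space. Then $X$ is also a $\Delta$-space. In particular, if a Tychonoff space is a countable union of compact $\Delta$-spaces, then it is also a $\Delta$-space.
   Context: A topological space $X$ is a $\Delta$-space if for every decreasing sequence $\{D_n: n \in \omega\}$ of subsets of $X$ with empty intersection there is a decreasing sequence $\{V_n: n \in \omega\}$ of open subsets of $X$, also with empty intersection, such that $D_n \subset V_n$ for every $n \in \omega$. *)

theory Defs
  imports "HOL-Analysis.Analysis"
begin

text \<open>The library's \<^const>\<open>completely_regular_space\<close> carries no separation axiom for points,
  so the Hausdorff property is required in addition.\<close>

definition Tychonoff_space :: "'a topology \<Rightarrow> bool" where
  "Tychonoff_space X \<longleftrightarrow> completely_regular_space X \<and> Hausdorff_space X"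

definition Delta_space :: "'a topology \<Rightarrow> bool" where
  "Delta_space X \<longleftrightarrow>
    (\<forall>D :: nat \<Rightarrow> 'a set.
       (\<forall>n. D n \<subseteq> topspace X) \<and> decseq D \<and> (\<Inter>n. D n) = {} \<longrightarrow>
       (\<exists>V :: nat \<Rightarrow> 'a set.
          (\<forall>n. openin X (V n)) \<and> decseq V \<and> (\<Inter>n. V n) = {} \<and> (\<forall>n. D n \<subseteq> V n)))"

end

theory Submission
  imports Defs
begin

text \<open>Let \<open>S\<^sub>0, S\<^sub>1, \<dots>\<close> be a closed cover of \<open>X\<close> by \<open>\<Delta>\<close>-spaces, and let \<open>D\<close> be a decreasing
  sequence with empty intersection. Relative to a closed set \<open>S\<close>, an open expansion of the traces
  \<open>D\<^sub>n \<inter> S\<close> becomes open in \<open>X\<close> once the open set \<open>X - S\<close> is added to each of its terms. The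
  resulting sequence expands \<open>D\<close> itself and its intersection misses \<open>S\<close>
  (\<open>open_expansion_vanishing_on_closed\<close>). Given such an expansion \<open>U k\<close> for each \<open>S\<^sub>k\<close>, the diagonal
  intersections \<open>U 0 n \<inter> \<dots> \<inter> U n n\<close> are finite, hence open; they decrease and contain \<open>D\<^sub>n\<close>, and
  their total intersection misses every \<open>S\<^sub>k\<close>, so it is empty. In a Hausdorff space compact
  sets are closed, which reduces the compact case to the closed one.\<close>

lemma Delta_spaceD:
  assumes "Delta_space X" "\<And>n. D n \<subseteq> topspace X" "decseq D" "(\<Inter>n. D n) = {}"
  obtains V where "\<And>n. openin X (V n)" "decseq V" "(\<Inter>n. V n) = {}" "\<And>n. D n \<subseteq> V n"
  using assms unfolding Delta_space_def by metis

lemma open_expansion_vanishing_on_closed: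
  assumes "closedin X S" and "Delta_space (subtopology X S)"
    and D: "\<And>n. D n \<subseteq> topspace X" "decseq D" "(\<Inter>n. D n) = {}"
  obtains U where "\<And>n. openin X (U n)" "decseq U" "(\<Inter>n. U n) \<inter> S = {}" "\<And>n. D n \<subseteq> U n"
proof -
  have "decseq (\<lambda>n. D n \<inter> S)"
    using D(2) unfolding decseq_def by blast
  moreover have "(\<Inter>n. D n \<inter> S) = {}"
    using D(3) by blast
  ultimately obtain V where V: "\<And>n. openin (subtopology X S) (V n)" "decseq V"
      "(\<Inter>n. V n) = {}" "\<And>n. D n \<inter> S \<subseteq> V n"
    using Delta_spaceD[OF assms(2), of "\<lambda>n. D n \<inter> S"] D(1)
    by (metis topspace_subtopology Int_mono order_refl)
  define U where "U n = V n \<union> (topspace X - S)" for n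
  show thesis
  proof
    show "openin X (U n)" for n
    proof -
      obtain T where T: "openin X T" "V n = T \<inter> S"
        using V(1)[of n] unfolding openin_subtopology by blast
      then have "U n = T \<union> (topspace X - S)"
        using openin_subset[OF T(1)] unfolding U_def by blast
      then show ?thesis
        using T(1) assms(1) by (simp add: closedin_def openin_Un)
    qed
    show "decseq U"
      using V(2) unfolding decseq_def U_def by blast
    show "(\<Inter>n. U n) \<inter> S = {}"
      using V(3) unfolding U_def by blast
    show "D n \<subseteq> U n" for n
      using V(4)[of n] D(1)[of n] unfolding U_def by blast
  qed
qed

lemma Delta_space_countable_closed_Union:
  fixes S :: "nat \<Rightarrow> 'a set"
  assumes "\<And>k. closedin X (S k)" "\<And>k. Delta_space (subtopology X (S k))"
    and cover: "topspace X \<subseteq> (\<Union>k. S k)"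
  shows "Delta_space X"
  unfolding Delta_space_def
proof (intro allI impI, elim conjE)
  fix D :: "nat \<Rightarrow> 'a set"
  assume D: "\<forall>n. D n \<subseteq> topspace X" "decseq D" "(\<Inter>n. D n) = {}"
  have "\<exists>U. (\<forall>n. openin X (U n)) \<and> decseq U \<and> (\<Inter>n. U n) \<inter> S k = {} \<and> (\<forall>n. D n \<subseteq> U n)" for k
    using open_expansion_vanishing_on_closed[OF assms(1,2), of D k] D by metis
  then obtain U where U: "\<And>k n. openin X (U k n)" "\<And>k. decseq (U k)"
      "\<And>k. (\<Inter>n. U k n) \<inter> S k = {}" "\<And>k n. D n \<subseteq> U k n"
    by metis
  define W where "W n = (\<Inter>k\<le>n. U k n)" for n
  have W_open: "openin X (W n)" for n
    unfolding W_def using U(1) by (intro openin_INT2) auto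
  moreover have "decseq W"
    unfolding decseq_def W_def
  proof (intro allI impI)
    fix m n :: nat
    assume "m \<le> n"
    then have "U k n \<subseteq> U k m" for k
      using U(2)[of k] by (simp add: decseqD)
    with \<open>m \<le> n\<close> show "(\<Inter>k\<le>n. U k n) \<subseteq> (\<Inter>k\<le>m. U k m)"
      by (meson INF_mono atMost_iff order_trans)
  qed
  moreover have "(\<Inter>n. W n) = {}"
  proof (rule ccontr)
    assume "(\<Inter>n. W n) \<noteq> {}"
    then obtain x where x: "\<And>n. x \<in> W n"
      by blast
    then obtain k where "x \<in> S k"
      using cover openin_subset[OF W_open] by blast
    then obtain n where n: "x \<notin> U k n"
      using U(3)[of k] by blast
    \<comment> \<open>The factor \<open>U k\<close> enters the diagonal only from index \<open>k\<close> on.\<close>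
    have "x \<in> U k (max k n)"
      using x[of "max k n"] unfolding W_def by simp
    then show False
      using n decseqD[OF U(2), of n "max k n" k] by auto
  qed
  moreover have "D n \<subseteq> W n" for n
    using U(4) unfolding W_def by blast
  ultimately show "\<exists>V. (\<forall>n. openin X (V n)) \<and> decseq V \<and> (\<Inter>n. V n) = {} \<and> (\<forall>n. D n \<subseteq> V n)"
    by blast
qed

lemma Delta_space_empty:
  assumes "topspace X = {}"
  shows "Delta_space X"
  unfolding Delta_space_def using assms by (metis openin_empty subset_empty)

theorem proposition2p2:
  fixes X :: "'a topology"
  assumes "Tychonoff_space X"
  shows "(\<forall>S :: nat \<Rightarrow> 'a set.
            (\<forall>n. closedin X (S n) \<and> Delta_space (subtopology X (S n))) \<and>
            (\<Union>n. S n) = topspace X \<longrightarrow> Delta_space X) \<and>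
         (\<forall>\<K> :: 'a set set.
            countable \<K> \<and> (\<forall>K\<in>\<K>. compactin X K \<and> Delta_space (subtopology X K)) \<and>
            \<Union>\<K> = topspace X \<longrightarrow> Delta_space X)"
proof (intro conjI allI impI; elim conjE)
  fix S :: "nat \<Rightarrow> 'a set"
  assume "\<forall>n. closedin X (S n) \<and> Delta_space (subtopology X (S n))" "(\<Union>n. S n) = topspace X"
  then show "Delta_space X"
    by (intro Delta_space_countable_closed_Union[of X S]) auto
next
  fix \<K> :: "'a set set"
  assume \<K>: "countable \<K>" "\<forall>K\<in>\<K>. compactin X K \<and> Delta_space (subtopology X K)"
    "\<Union>\<K> = topspace X"
  show "Delta_space X"
  proof (cases "\<K> = {}")
    case True
    then show ?thesis
      using \<K>(3) by (simp add: Delta_space_empty)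
  next
    case False
    have "Hausdorff_space X"
      using assms unfolding Tychonoff_space_def by simp
    then have "closedin X K" if "K \<in> \<K>" for K
      using \<K>(2) that compactin_imp_closedin by blast
    moreover have "from_nat_into \<K> n \<in> \<K>" for n
      using False by (rule from_nat_into)
    moreover have "(\<Union>n. from_nat_into \<K> n) = topspace X"
      using range_from_nat_into[OF False \<K>(1)] \<K>(3) by simp
    ultimately show ?thesis
      using \<K>(2) by (intro Delta_space_countable_closed_Union[of X "from_nat_into \<K>"]) auto
  qed
qed

end
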